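(* Let $X$ be a regular, $\omega_1$-compact space. If $X$ has a sharp base, then $X$ is metrizable.
   Context: All spaces are $T_1$ topological spaces (so regular spaces are $T_1$); $\omega=\{0,1,2,\dots\}$. A base $\mathcal{B}$ for a space $X$ is sharp if, whenever $x\in X$ and $(B_n)_{n\in\omega}$ is a sequence of pairwise distinct elements of $\mathcal{B}$ each containing $x$, the collection $\{\bigcap_{j\le n}B_j:n\in\omega\}$ is a local base at $x$. A space is $\omega_1$-compact if every uncountable subset has a limit point, equivalently every closed discrete subset is countable. *)

theory Defs
  imports "HOL-Analysis.Analysis"
begin

definition base_of :: "'a topology \<Rightarrow> 'a set set \<Rightarrow> bool" where
  "base_of X \<B> \<longleftrightarrow> openin X = arbitrary union_of (\<lambda>V. V \<in> \<B>)"

definition local_base_at :: "'a topology \<Rightarrow> 'a \<Rightarrow> 'a set set \<Rightarrow> bool" where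
  "local_base_at X x \<N> \<longleftrightarrow>
     (\<forall>V\<in>\<N>. openin X V \<and> x \<in> V) \<and>
     (\<forall>W. openin X W \<and> x \<in> W \<longrightarrow> (\<exists>V\<in>\<N>. V \<subseteq> W))"

definition sharp_base :: "'a topology \<Rightarrow> 'a set set \<Rightarrow> bool" where
  "sharp_base X \<B> \<longleftrightarrow>
     base_of X \<B> \<and>
     (\<forall>x\<in>topspace X. \<forall>B :: nat \<Rightarrow> 'a set.
        inj B \<and> (\<forall>n. B n \<in> \<B> \<and> x \<in> B n) \<longrightarrow>
        local_base_at X x (range (\<lambda>n. \<Inter>j\<le>n. B j)))"

text \<open>The limit points of \<open>S\<close> are the elements of \<open>X derived_set_of S\<close>; they need not lie in \<open>S\<close>.\<close>

definition omega1_compact_space :: "'a topology \<Rightarrow> bool" where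
  "omega1_compact_space X \<longleftrightarrow>
     (\<forall>S. S \<subseteq> topspace X \<and> uncountable S \<longrightarrow> X derived_set_of S \<noteq> {})"

end

theory Submission
  imports Defs
begin

text \<open>
  The space turns out to be second countable, so that Urysohn's metrization theorem applies to it.

  Sharpness makes a base sparse: by the \<open>T\<^sub>1\<close> axiom, infinitely many members of the base through
  \<open>x\<close> shrink to \<open>{x}\<close>, so two distinct points lie together in only finitely many members.  This has
  two consequences.

  First, a non-isolated point \<open>x\<close> lies in only countably many members.  Indeed, if it lies in
  infinitely many of them, then it has a countable local base, every member through \<open>x\<close> contains one of
  the countably many neighbourhoods in it, and each of these neighbourhoods, having a second point, is
  contained in only finitely many members.  Hence the closed set of non-isolated points can be covered
  by countably many members of the base that refine any given open cover, by the usual argument with a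
  maximal set of which no two points share a member: such a set is closed and discrete, hence countable
  in an \<open>\<omega>\<^sub>1\<close>-compact space.  What is left is a closed set of isolated points, hence countable as well, and
  so \<open>X\<close> is Lindelof (\<open>sharp_base_imp_Lindelof_space\<close>).

  Secondly, let \<open>\<G> n\<close> consist of the members of the base that are singletons or are contained in at
  least \<open>n\<close> members.  A member with two points belongs to \<open>\<G> n\<close> for finitely many \<open>n\<close> only, so
  choosing \<open>g n \<in> \<G> n\<close> around \<open>x\<close> produces infinitely many different members unless a singleton
  occurs, and in both cases the finite intersections of the \<open>g n\<close> form a local base at \<open>x\<close>
  (\<open>sharp_base_imp_weak_development\<close>).  In a Lindelof space each \<open>\<G> n\<close> can be thinned out to a
  countable cover, and the finite intersections of the chosen sets form a countable base.
\<close>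

section \<open>Urysohn's metrization theorem\<close>

text \<open>
  For each pair of basic sets \<open>U\<close>, \<open>V\<close> with the closure of \<open>U\<close> inside \<open>V\<close>, Urysohn's lemma gives a
  function separating \<open>U\<close> from the complement of \<open>V\<close>.  There are countably many such pairs, and the
  functions together embed \<open>X\<close> in a countable power of the real line.
\<close>
lemma regular_second_countable_imp_metrizable_space:
  assumes "t1_space X" "regular_space X" "second_countable X"
  shows "metrizable_space X"
proof -
  obtain \<B> where \<B>: "countable \<B>" "\<And>V. V \<in> \<B> \<Longrightarrow> openin X V"
      "\<And>U x. openin X U \<Longrightarrow> x \<in> U \<Longrightarrow> \<exists>V\<in>\<B>. x \<in> V \<and> V \<subseteq> U"
    using assms(3) unfolding second_countable_def by metis
  have "normal_space X"
    using assms(2,3) regular_Lindelof_imp_normal_space second_countable_imp_Lindelof_space by blast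
  define I where "I = {(U, V). U \<in> \<B> \<and> V \<in> \<B> \<and> X closure_of U \<subseteq> V}"
  have "countable I"
    by (rule countable_subset[of _ "\<B> \<times> \<B>"]) (auto simp: I_def \<B>(1))
  have "\<exists>f. continuous_map X euclideanreal f \<and> f ` (X closure_of fst i) \<subseteq> {0}
            \<and> f ` (topspace X - snd i) \<subseteq> {1}" if "i \<in> I" for i
  proof -
    have "closedin X (X closure_of fst i)" "closedin X (topspace X - snd i)"
      using that \<B>(2) by (auto simp: I_def)
    moreover have "disjnt (X closure_of fst i) (topspace X - snd i)"
      using that by (auto simp: I_def disjnt_def)
    ultimately show ?thesis
      using \<open>normal_space X\<close> Urysohn_lemma_alt by metis
  qed
  then obtain f where f: "\<And>i. i \<in> I \<Longrightarrow> continuous_map X euclideanreal (f i)"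
      "\<And>i. i \<in> I \<Longrightarrow> f i ` (X closure_of fst i) \<subseteq> {0::real}"
      "\<And>i. i \<in> I \<Longrightarrow> f i ` (topspace X - snd i) \<subseteq> {1}"
    by metis
  have separate: "\<exists>i\<in>I. f i x = 0 \<and> (\<forall>y \<in> topspace X - W. f i y = 1)"
    if "openin X W" "x \<in> W" for W x
  proof -
    obtain V where V: "V \<in> \<B>" "x \<in> V" "V \<subseteq> W"
      using \<B>(3) \<open>openin X W\<close> \<open>x \<in> W\<close> by blast
    have "closedin X (topspace X - V)" "x \<in> topspace X - (topspace X - V)"
      using V \<B>(2)[OF V(1)] openin_subset by auto
    then obtain T where T: "openin X T" "x \<in> T" "disjnt (topspace X - V) (X closure_of T)"
      using \<open>regular_space X\<close> unfolding regular_space by meson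
    then have "X closure_of T \<subseteq> V"
      using closure_of_subset_topspace[of X T] by (auto simp: disjnt_iff)
    moreover obtain U where U: "U \<in> \<B>" "x \<in> U" "U \<subseteq> T"
      using \<B>(3)[OF T(1,2)] by blast
    ultimately have "(U, V) \<in> I"
      using V(1) closure_of_mono[OF U(3), of X] by (auto simp: I_def)
    moreover have "x \<in> X closure_of U"
      using closure_of_subset[OF openin_subset[OF \<B>(2)[OF U(1)]]] U(2) by (rule subsetD)
    ultimately have "f (U, V) x = 0" "\<forall>y \<in> topspace X - W. f (U, V) y = 1"
      using f(2,3)[of "(U, V)"] V(3) by auto
    then show ?thesis
      using \<open>(U, V) \<in> I\<close> by blast
  qed
  define e where "e = (\<lambda>x. \<lambda>i\<in>I. f i x)"
  define Y where "Y = subtopology (powertop_real I) (e ` topspace X)"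
  have top_Y: "topspace Y = e ` topspace X"
    by (auto simp: Y_def e_def)
  have "continuous_map X Y e"
    unfolding Y_def continuous_map_in_subtopology
    using f(1) by (auto simp: e_def continuous_map_componentwise)
  moreover have "open_map X Y e"
    unfolding open_map_def
  proof (intro allI impI)
    fix W assume W: "openin X W"
    show "openin Y (e ` W)"
    proof (subst openin_subopen, intro ballI)
      fix z assume "z \<in> e ` W"
      then obtain x where x: "x \<in> W" "z = e x" by blast
      then obtain i where i: "i \<in> I" "f i x = 0" "\<forall>y \<in> topspace X - W. f i y = 1"
        using separate[OF W] by blast
      define N where "N = {y \<in> topspace Y. y i \<in> {..<1}}"
      have "continuous_map Y euclideanreal (\<lambda>y. y i)"
        unfolding Y_def using \<open>i \<in> I\<close>
        by (intro continuous_map_from_subtopology continuous_map_product_projection)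
      then have "openin Y N"
        unfolding N_def by (rule openin_continuous_map_preimage) simp
      moreover have "z \<in> N"
        using x i W openin_subset by (fastforce simp: N_def top_Y e_def)
      moreover have "N \<subseteq> e ` W"
        using i by (force simp: N_def top_Y e_def)
      ultimately show "\<exists>T. openin Y T \<and> z \<in> T \<and> T \<subseteq> e ` W" by blast
    qed
  qed
  moreover have "inj_on e (topspace X)"
  proof (rule inj_onI, rule ccontr)
    fix x y assume xy: "x \<in> topspace X" "y \<in> topspace X" "e x = e y" "x \<noteq> y"
    then obtain W where W: "openin X W" "x \<in> W" "y \<notin> W"
      using \<open>t1_space X\<close> unfolding t1_space_def by blast
    then obtain i where "i \<in> I" "f i x = 0" "f i y = 1"
      using separate xy by blast
    then show False
      using fun_cong[OF \<open>e x = e y\<close>, of i] by (simp add: e_def)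
  qed
  ultimately have "X homeomorphic_space subtopology Y (e ` topspace X)"
    by (intro embedding_map_imp_homeomorphic_space injective_open_imp_embedding_map)
  moreover have "metrizable_space (powertop_real I)"
  proof -
    have "countable {i \<in> I. \<not> (\<exists>a. topspace euclideanreal \<subseteq> {a})}"
      using \<open>countable I\<close> by (rule countable_subset[rotated]) auto
    then show ?thesis
      by (simp add: metrizable_space_product_topology metrizable_space_euclidean)
  qed
  then have "metrizable_space (subtopology Y (e ` topspace X))"
    by (simp add: Y_def metrizable_space_subtopology)
  ultimately show ?thesis
    using homeomorphic_metrizable_space by blast
qed

section \<open>Countable subcovers in omega-one-compact spaces\<close>

lemma omega1_compact_space_imp_countable:
  assumes "omega1_compact_space X" "S \<subseteq> topspace X" "X derived_set_of S = {}"
  shows "countable S"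
  using assms unfolding omega1_compact_space_def by blast

text \<open>
  A maximal set \<open>D\<close> of points of \<open>S\<close>, no two of them in a common member of the cover, has no limit
  point and is therefore countable; by maximality the members that meet \<open>D\<close> cover \<open>S\<close>.
\<close>
lemma point_countable_cover_imp_countable_subcover:
  assumes "t1_space X" "omega1_compact_space X" "closedin X S"
    and "\<And>V. V \<in> \<V> \<Longrightarrow> openin X V" and "S \<subseteq> \<Union>\<V>"
    and "\<And>x. x \<in> S \<Longrightarrow> countable {V \<in> \<V>. x \<in> V}"
  shows "\<exists>\<C>. countable \<C> \<and> \<C> \<subseteq> \<V> \<and> S \<subseteq> \<Union>\<C>"
proof -
  define \<A> where "\<A> = {D. D \<subseteq> S \<and> (\<forall>V\<in>\<V>. \<forall>x\<in>D\<inter>V. \<forall>y\<in>D\<inter>V. x = y)}"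
  have "\<Union>C \<in> \<A>" if "C \<in> chains \<A>" for C
  proof -
    have "C \<subseteq> \<A>" and chain: "\<And>D E. D \<in> C \<Longrightarrow> E \<in> C \<Longrightarrow> D \<subseteq> E \<or> E \<subseteq> D"
      using that by (auto simp: chains_def chain_subset_def)
    have single: "x = y"
      if "V \<in> \<V>" "x \<in> V" "y \<in> V" "D \<in> C" "E \<in> C" "x \<in> D" "y \<in> E" for V x y D E
      using \<open>C \<subseteq> \<A>\<close> chain[OF \<open>D \<in> C\<close> \<open>E \<in> C\<close>] that unfolding \<A>_def by blast
    have "\<Union>C \<subseteq> S"
      using \<open>C \<subseteq> \<A>\<close> by (auto simp: \<A>_def)
    moreover have "\<forall>V\<in>\<V>. \<forall>x\<in>\<Union>C \<inter> V. \<forall>y\<in>\<Union>C \<inter> V. x = y"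
      by (intro ballI) (elim IntE UnionE, rule single)
    ultimately show ?thesis
      unfolding \<A>_def mem_Collect_eq by (intro conjI)
  qed
  then obtain D where "D \<in> \<A>" and max: "\<And>E. E \<in> \<A> \<Longrightarrow> D \<subseteq> E \<Longrightarrow> E = D"
    using Zorn_Lemma[of \<A>] by metis
  then have "D \<subseteq> S" and D: "\<And>V x y. V \<in> \<V> \<Longrightarrow> x \<in> D \<inter> V \<Longrightarrow> y \<in> D \<inter> V \<Longrightarrow> x = y"
    by (auto simp: \<A>_def)
  have "x \<notin> X derived_set_of D" for x
  proof
    assume x: "x \<in> X derived_set_of D"
    then have "x \<in> S"
      using derived_set_of_mono[OF \<open>D \<subseteq> S\<close>, of X] \<open>closedin X S\<close>
      by (auto simp: closedin_contains_derived_set)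
    then obtain V where "V \<in> \<V>" "x \<in> V"
      using \<open>S \<subseteq> \<Union>\<V>\<close> by blast
    then have "infinite (D \<inter> V)"
      using x assms(1,4) by (simp add: t1_space_derived_set_of_infinite_openin)
    moreover have "\<exists>d. D \<inter> V \<subseteq> {d}"
      using D[OF \<open>V \<in> \<V>\<close>] by blast
    ultimately show False
      using finite_subset by blast
  qed
  then have "countable D"
    using \<open>D \<subseteq> S\<close> closedin_subset[OF \<open>closedin X S\<close>]
    by (intro omega1_compact_space_imp_countable[OF assms(2)]) auto
  define \<C> where "\<C> = (\<Union>d\<in>D. {V \<in> \<V>. d \<in> V})"
  have "countable \<C>"
    unfolding \<C>_def using \<open>countable D\<close> \<open>D \<subseteq> S\<close> assms(6) by blast
  moreover have "S \<subseteq> \<Union>\<C>"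
  proof
    fix x assume "x \<in> S"
    show "x \<in> \<Union>\<C>"
    proof (rule ccontr)
      assume x: "x \<notin> \<Union>\<C>"
      then have "insert x D \<in> \<A>"
        using \<open>x \<in> S\<close> \<open>D \<subseteq> S\<close> D unfolding \<A>_def \<C>_def by blast
      then have "x \<in> D"
        using max by blast
      then show False
        using x \<open>x \<in> S\<close> \<open>S \<subseteq> \<Union>\<V>\<close> unfolding \<C>_def by blast
    qed
  qed
  ultimately show ?thesis
    unfolding \<C>_def by blast
qed

section \<open>Sparsity of sharp bases\<close>

lemma sharp_baseD:
  assumes "sharp_base X \<B>"
  shows "\<And>V. V \<in> \<B> \<Longrightarrow> openin X V"
    and "\<And>U x. openin X U \<Longrightarrow> x \<in> U \<Longrightarrow> \<exists>V\<in>\<B>. x \<in> V \<and> V \<subseteq> U"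
    and "\<And>x (B :: nat \<Rightarrow> _). x \<in> topspace X \<Longrightarrow> inj B \<Longrightarrow> range B \<subseteq> {V \<in> \<B>. x \<in> V} \<Longrightarrow>
           local_base_at X x (range (\<lambda>n. \<Inter>j\<le>n. B j))"
proof -
  have "openin X = arbitrary union_of (\<lambda>V. V \<in> \<B>)"
    using assms by (simp add: sharp_base_def base_of_def)
  then show "\<And>V. V \<in> \<B> \<Longrightarrow> openin X V"
    and "\<And>U x. openin X U \<Longrightarrow> x \<in> U \<Longrightarrow> \<exists>V\<in>\<B>. x \<in> V \<and> V \<subseteq> U"
    unfolding openin_topology_base_unique by blast+
  show "\<And>x (B :: nat \<Rightarrow> _). x \<in> topspace X \<Longrightarrow> inj B \<Longrightarrow> range B \<subseteq> {V \<in> \<B>. x \<in> V} \<Longrightarrow>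
           local_base_at X x (range (\<lambda>n. \<Inter>j\<le>n. B j))"
    using assms unfolding sharp_base_def by blast
qed

text \<open>
  Infinitely many members through both \<open>x\<close> and \<open>y\<close> would yield a local base at \<open>x\<close> all of whose
  elements contain \<open>y\<close>.
\<close>
lemma sharp_base_finite_common_members:
  assumes "sharp_base X \<B>" "t1_space X" "x \<in> topspace X" "y \<in> topspace X" "x \<noteq> y"
  shows "finite {V \<in> \<B>. x \<in> V \<and> y \<in> V}"
proof (rule ccontr)
  assume "infinite {V \<in> \<B>. x \<in> V \<and> y \<in> V}"
  then obtain B :: "nat \<Rightarrow> _" where B: "inj B" "range B \<subseteq> {V \<in> \<B>. x \<in> V \<and> y \<in> V}"
    using infinite_countable_subset by blast
  then have "local_base_at X x (range (\<lambda>n. \<Inter>j\<le>n. B j))"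
    by (intro sharp_baseD(3)[OF assms(1,3)]) auto
  moreover obtain U where "openin X U" "x \<in> U" "y \<notin> U"
    using assms unfolding t1_space_def by blast
  ultimately obtain n where "(\<Inter>j\<le>n. B j) \<subseteq> U"
    unfolding local_base_at_def by blast
  then show False
    using B \<open>y \<notin> U\<close> by blast
qed

lemma sharp_base_finite_supersets:
  assumes "sharp_base X \<B>" "t1_space X" "S \<subseteq> topspace X" "x \<in> S" "y \<in> S" "x \<noteq> y"
  shows "finite {V \<in> \<B>. S \<subseteq> V}"
proof (rule finite_subset)
  show "finite {V \<in> \<B>. x \<in> V \<and> y \<in> V}"
    using assms by (intro sharp_base_finite_common_members) auto
qed (use assms in auto)

text \<open>
  If infinitely many members contain \<open>x\<close>, then \<open>x\<close> has a countable local base, and every member through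
  \<open>x\<close> contains one of its elements.  As \<open>x\<close> is not isolated, such an element has a second point, so it
  is contained in finitely many members only.
\<close>
lemma sharp_base_countable_at_limit_point:
  assumes "sharp_base X \<B>" "t1_space X" "x \<in> X derived_set_of topspace X"
  shows "countable {V \<in> \<B>. x \<in> V}"
proof (cases "finite {V \<in> \<B>. x \<in> V}")
  case False
  have "x \<in> topspace X"
    using assms(3) by (simp add: in_derived_set_of)
  obtain B :: "nat \<Rightarrow> _" where B: "inj B" "range B \<subseteq> {V \<in> \<B>. x \<in> V}"
    using infinite_countable_subset[OF False] by blast
  define U where "U n = (\<Inter>j\<le>n. B j)" for n
  have lb: "local_base_at X x (range U)"
    unfolding U_def using sharp_baseD(3)[OF assms(1) \<open>x \<in> topspace X\<close> B] .
  have U: "openin X (U n)" "x \<in> U n" for n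
    using lb unfolding local_base_at_def by blast+
  have "finite {V \<in> \<B>. U n \<subseteq> V}" for n
  proof -
    obtain y where "y \<noteq> x" "y \<in> U n"
      using assms(3) U[of n] unfolding in_derived_set_of by blast
    then show ?thesis
      using U[of n] openin_subset[OF U(1)]
      by (intro sharp_base_finite_supersets[OF assms(1,2), of _ x y]) auto
  qed
  then have "countable (\<Union>n. {V \<in> \<B>. U n \<subseteq> V})"
    by (intro countable_UN) (auto intro: countable_finite)
  moreover have "{V \<in> \<B>. x \<in> V} \<subseteq> (\<Union>n. {V \<in> \<B>. U n \<subseteq> V})"
    using lb sharp_baseD(1)[OF assms(1)] unfolding local_base_at_def by blast
  ultimately show ?thesis
    by (rule countable_subset[rotated])
qed (simp add: countable_finite)

text \<open>
  The non-isolated points form a closed set at which the base is point-countable; the part of the space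
  missed by countably many open sets covering them is closed and consists of isolated points.
\<close>
lemma sharp_base_imp_Lindelof_space:
  assumes "sharp_base X \<B>" "t1_space X" "omega1_compact_space X"
  shows "Lindelof_space X"
  unfolding Lindelof_space_alt
proof (intro allI impI, elim conjE)
  fix \<U> assume \<U>: "\<forall>U\<in>\<U>. openin X U" "topspace X \<subseteq> \<Union>\<U>"
  define S where "S = X derived_set_of topspace X"
  define \<V> where "\<V> = {V \<in> \<B>. \<exists>U\<in>\<U>. V \<subseteq> U}"
  have S_sub: "S \<subseteq> topspace X"
    by (simp add: S_def derived_set_of_subset_topspace)
  have "closedin X S"
    unfolding S_def using closedin_derived_set_of_gen[OF assms(2)] by blast
  moreover have "S \<subseteq> \<Union>\<V>"
  proof
    fix x assume "x \<in> S"
    then obtain U where "U \<in> \<U>" "x \<in> U"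
      using S_sub \<U> by blast
    moreover then obtain V where "V \<in> \<B>" "x \<in> V" "V \<subseteq> U"
      using sharp_baseD(2)[OF assms(1)] \<U> by meson
    ultimately show "x \<in> \<Union>\<V>"
      unfolding \<V>_def by blast
  qed
  moreover have "countable {V \<in> \<V>. x \<in> V}" if "x \<in> S" for x
  proof (rule countable_subset)
    show "countable {V \<in> \<B>. x \<in> V}"
      using sharp_base_countable_at_limit_point[OF assms(1,2)] that by (simp add: S_def)
  qed (auto simp: \<V>_def)
  moreover have "openin X V" if "V \<in> \<V>" for V
    using that sharp_baseD(1)[OF assms(1)] by (simp add: \<V>_def)
  ultimately obtain \<C> where \<C>: "countable \<C>" "\<C> \<subseteq> \<V>" "S \<subseteq> \<Union>\<C>"
    using point_countable_cover_imp_countable_subcover[OF assms(2,3), of S \<V>] by metis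
  have "\<forall>V\<in>\<C>. \<exists>U\<in>\<U>. V \<subseteq> U"
    using \<C>(2) by (auto simp: \<V>_def)
  then obtain u where u: "\<And>V. V \<in> \<C> \<Longrightarrow> u V \<in> \<U> \<and> V \<subseteq> u V"
    by metis
  define R where "R = topspace X - \<Union>(u ` \<C>)"
  have "closedin X R"
    unfolding R_def using u \<U> by (intro closedin_diff closedin_topspace openin_Union) auto
  have "X derived_set_of R \<subseteq> R"
    using \<open>closedin X R\<close> by (simp add: closedin_contains_derived_set)
  moreover have "X derived_set_of R \<subseteq> S"
    unfolding S_def R_def by (intro derived_set_of_mono) auto
  moreover have "R \<inter> S = {}"
    using \<C>(3) u unfolding R_def by blast
  ultimately have "X derived_set_of R = {}"
    by blast
  then have "countable R"
    by (intro omega1_compact_space_imp_countable[OF assms(3)]) (auto simp: R_def)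
  have "\<forall>x\<in>R. \<exists>U\<in>\<U>. x \<in> U"
    using \<U> by (auto simp: R_def)
  then obtain w where w: "\<And>x. x \<in> R \<Longrightarrow> w x \<in> \<U> \<and> x \<in> w x"
    by metis
  have "countable (u ` \<C> \<union> w ` R)"
    using \<C>(1) \<open>countable R\<close> by simp
  moreover have "u ` \<C> \<union> w ` R \<subseteq> \<U>"
    using u w by auto
  moreover have "topspace X - R \<subseteq> \<Union>(u ` \<C>)" "R \<subseteq> \<Union>(w ` R)"
    using w by (auto simp: R_def)
  then have "topspace X \<subseteq> \<Union>(u ` \<C> \<union> w ` R)"
    unfolding Union_Un_distrib subset_iff Un_iff Diff_iff by meson
  ultimately show "\<exists>\<V>. countable \<V> \<and> \<V> \<subseteq> \<U> \<and> topspace X \<subseteq> \<Union>\<V>"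
    by meson
qed

section \<open>Weak developments\<close>

text \<open>
  In a development, the stars of \<open>x\<close> in the covers form a local base at \<open>x\<close>.  Here only the finite
  intersections of one member through \<open>x\<close> from each cover are required to do so.
\<close>
definition weak_development :: "'a topology \<Rightarrow> (nat \<Rightarrow> 'a set set) \<Rightarrow> bool" where
  "weak_development X \<G> \<longleftrightarrow>
     (\<forall>n. (\<forall>G\<in>\<G> n. openin X G) \<and> topspace X \<subseteq> \<Union>(\<G> n)) \<and>
     (\<forall>x\<in>topspace X. \<forall>g. (\<forall>n. g n \<in> \<G> n \<and> x \<in> g n) \<longrightarrow>
        local_base_at X x (range (\<lambda>n. \<Inter>j\<le>n. g j)))"

lemma openin_Int_finite_Inter:
  assumes "finite \<F>" "\<And>V. V \<in> \<F> \<Longrightarrow> openin X V"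
  shows "openin X (topspace X \<inter> \<Inter>\<F>)"
  using assms
proof (induction \<F>)
  case (insert V \<F>)
  then have "openin X (V \<inter> (topspace X \<inter> \<Inter>\<F>))"
    by blast
  then show ?case
    by (simp add: Int_left_commute)
qed simp

lemma Lindelof_weak_development_imp_second_countable:
  assumes "Lindelof_space X" "weak_development X \<G>"
  shows "second_countable X"
proof -
  have \<G>: "\<And>n G. G \<in> \<G> n \<Longrightarrow> openin X G" "\<And>n. topspace X \<subseteq> \<Union>(\<G> n)"
    using assms(2) unfolding weak_development_def by blast+
  have "\<exists>\<C>. countable \<C> \<and> \<C> \<subseteq> \<G> n \<and> topspace X \<subseteq> \<Union>\<C>" for n
    using assms(1) \<G> unfolding Lindelof_space_alt by meson
  then obtain \<C> where \<C>: "\<And>n. countable (\<C> n)" "\<And>n. \<C> n \<subseteq> \<G> n"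
      "\<And>n. topspace X \<subseteq> \<Union>(\<C> n)"
    by metis
  define \<D> where "\<D> = (\<lambda>\<F>. topspace X \<inter> \<Inter>\<F>) ` {\<F>. finite \<F> \<and> \<F> \<subseteq> (\<Union>n. \<C> n)}"
  have "countable \<D>"
    unfolding \<D>_def using \<C>(1) by (intro countable_image countable_Collect_finite_subset) auto
  moreover have "\<forall>V\<in>\<D>. openin X V"
    using \<C>(2) \<G>(1) unfolding \<D>_def by (fastforce intro!: openin_Int_finite_Inter)
  moreover have "\<exists>V\<in>\<D>. x \<in> V \<and> V \<subseteq> U" if U: "openin X U" "x \<in> U" for U x
  proof -
    have x: "x \<in> topspace X"
      using U openin_subset by blast
    then have "\<exists>G. G \<in> \<C> n \<and> x \<in> G" for n
      using \<C>(3) by blast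
    then obtain g where g: "\<And>n. g n \<in> \<C> n" "\<And>n. x \<in> g n"
      by metis
    then have "\<forall>n. g n \<in> \<G> n \<and> x \<in> g n"
      using \<C>(2) by blast
    then have "local_base_at X x (range (\<lambda>n. \<Inter>j\<le>n. g j))"
      using assms(2) x unfolding weak_development_def by blast
    then obtain n where n: "(\<Inter>j\<le>n. g j) \<subseteq> U"
      using U unfolding local_base_at_def by blast
    define V where "V = topspace X \<inter> \<Inter>(g ` {..n})"
    have "V \<in> \<D>"
      using g(1) unfolding \<D>_def V_def by blast
    moreover have "x \<in> V"
      using x g(2) by (simp add: V_def)
    moreover have "V \<subseteq> U"
      using n by (auto simp: V_def)
    ultimately show ?thesis
      by blast
  qed
  ultimately show ?thesis
    unfolding second_countable_def by blast
qed

text \<open>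
  Finitely many neighbourhoods cannot form a local base at a non-isolated point of a \<open>T\<^sub>1\<close> space, since
  their intersection is a neighbourhood with a second point.
\<close>
lemma sharp_base_infinite_at_limit_point:
  assumes "sharp_base X \<B>" "t1_space X" "x \<in> X derived_set_of topspace X"
  shows "infinite {V \<in> \<B>. x \<in> V}"
proof
  assume fin: "finite {V \<in> \<B>. x \<in> V}"
  have x: "x \<in> topspace X"
    using assms(3) by (simp add: in_derived_set_of)
  define N where "N = topspace X \<inter> \<Inter>{V \<in> \<B>. x \<in> V}"
  have "openin X N" "x \<in> N"
    using fin sharp_baseD(1)[OF assms(1)] x
    unfolding N_def by (auto intro!: openin_Int_finite_Inter)
  then obtain y where y: "y \<in> topspace X" "y \<in> N" "y \<noteq> x"
    using assms(3) unfolding in_derived_set_of by meson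
  then obtain U where U: "openin X U" "x \<in> U" "y \<notin> U"
    using assms(2) x unfolding t1_space_def by metis
  then obtain V where "V \<in> \<B>" "x \<in> V" "V \<subseteq> U"
    using sharp_baseD(2)[OF assms(1) U(1,2)] by blast
  then have "y \<in> V"
    using y(2) by (simp add: N_def)
  then show False
    using \<open>V \<subseteq> U\<close> U(3) by blast
qed

lemma sharp_base_imp_weak_development:
  assumes "sharp_base X \<B>" "t1_space X"
  obtains \<G> where "weak_development X \<G>"
proof
  define \<G> where "\<G> n = {V \<in> \<B>. (\<exists>x. V = {x}) \<or>
    (\<exists>\<F>. finite \<F> \<and> card \<F> = n \<and> \<F> \<subseteq> {W \<in> \<B>. V \<subseteq> W})}" for n :: nat
  note op = sharp_baseD(1)[OF assms(1)] and base = sharp_baseD(2)[OF assms(1)]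
  have cover: "\<exists>V\<in>\<G> n. x \<in> V" if x: "x \<in> topspace X" for x n
  proof (cases "x \<in> X derived_set_of topspace X")
    case True
    then obtain \<F> where \<F>: "finite \<F>" "card \<F> = n" "\<F> \<subseteq> {V \<in> \<B>. x \<in> V}"
      using infinite_arbitrarily_large[OF sharp_base_infinite_at_limit_point[OF assms]] by blast
    then have "openin X (topspace X \<inter> \<Inter>\<F>)"
      using op by (intro openin_Int_finite_Inter) auto
    moreover have "x \<in> topspace X \<inter> \<Inter>\<F>"
      using x \<F>(3) by blast
    ultimately obtain V where V: "V \<in> \<B>" "x \<in> V" "V \<subseteq> topspace X \<inter> \<Inter>\<F>"
      using base by meson
    then have "\<F> \<subseteq> {W \<in> \<B>. V \<subseteq> W}"
      using \<F>(3) by blast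
    then show ?thesis
      using V \<F>(1,2) unfolding \<G>_def by blast
  next
    case False
    then obtain T where T: "openin X T" "x \<in> T" "\<And>y. y \<in> topspace X \<Longrightarrow> y \<in> T \<Longrightarrow> y = x"
      using x by (auto simp: in_derived_set_of)
    then obtain V where V: "V \<in> \<B>" "x \<in> V" "V \<subseteq> T"
      using base[OF T(1,2)] by blast
    then have "V = {x}"
      using T(3) openin_subset[OF op[OF V(1)]] by blast
    then show ?thesis
      using V unfolding \<G>_def by blast
  qed
  have local_base: "\<exists>n. (\<Inter>j\<le>n. g j) \<subseteq> W"
    if x: "x \<in> topspace X" and g: "\<And>n. g n \<in> \<G> n" "\<And>n. x \<in> g n"
      and W: "openin X W" "x \<in> W" for x g W
  proof (cases "\<exists>n. g n = {x}")
    case True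
    then show ?thesis
      using W by blast
  next
    case False
    have gB: "g n \<in> \<B>" for n
      using g(1)[of n] by (simp add: \<G>_def)
    \<comment> \<open>No member occurs infinitely often: it is contained in only finitely many members of the base,
      but in at least \<open>n\<close> of them if it occurs at place \<open>n\<close>.\<close>
    have "finite {n. g n = V}" if "V \<in> range g" for V
    proof -
      have V: "V \<in> \<B>" "x \<in> V" "V \<noteq> {x}"
        using that gB g(2) False by auto
      then obtain y where "y \<in> V" "x \<noteq> y"
        by blast
      then have fin: "finite {W \<in> \<B>. V \<subseteq> W}"
        using V openin_subset[OF op[OF V(1)]]
      by (intro sharp_base_finite_supersets[OF assms, of _ x y]) auto
      have "n \<le> card {W \<in> \<B>. V \<subseteq> W}" if n: "g n = V" for n
      proof -
        have "V \<noteq> {z}" for z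
          using V by blast
        then obtain \<F> where "card \<F> = n" "\<F> \<subseteq> {W \<in> \<B>. V \<subseteq> W}"
          using g(1)[of n] n unfolding \<G>_def by blast
        then show ?thesis
          using card_mono[OF fin] by blast
      qed
      then show ?thesis
        by (auto simp: finite_nat_set_iff_bounded_le)
    qed
    moreover have "(\<Union>V\<in>range g. {n. g n = V}) = UNIV"
      by blast
    ultimately have "infinite (range g)"
      by (metis finite_UN_I infinite_UNIV_nat)
    then obtain h :: "nat \<Rightarrow> _" where h: "inj h" "range h \<subseteq> range g"
      using infinite_countable_subset by blast
    moreover have "range g \<subseteq> {V \<in> \<B>. x \<in> V}"
      using gB g(2) by auto
    ultimately have "range h \<subseteq> {V \<in> \<B>. x \<in> V}"
      by simp
    then have "local_base_at X x (range (\<lambda>n. \<Inter>j\<le>n. h j))"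
      using sharp_baseD(3)[OF assms(1) x h(1)] by simp
    then obtain k where k: "(\<Inter>j\<le>k. h j) \<subseteq> W"
      using W unfolding local_base_at_def by blast
    \<comment> \<open>The sets \<open>h 0, \<dots>, h k\<close> all occur in a sufficiently long initial segment of \<open>g\<close>.\<close>
    have "\<forall>j. \<exists>i. h j = g i"
      using h(2) by blast
    then obtain i where i: "\<And>j. h j = g (i j)"
      by metis
    have "i j \<le> Max (i ` {..k})" if "j \<le> k" for j
      using that by auto
    then have "(\<Inter>j\<le>Max (i ` {..k}). g j) \<subseteq> (\<Inter>j\<le>k. h j)"
      unfolding i by blast
    then show ?thesis
      using k by blast
  qed
  show "weak_development X \<G>"
    unfolding weak_development_def
  proof (intro conjI allI ballI impI)
    fix n G assume "G \<in> \<G> n"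
    then show "openin X G"
      using op by (simp add: \<G>_def)
  next
    fix n show "topspace X \<subseteq> \<Union>(\<G> n)"
      using cover by blast
  next
    fix x g assume x: "x \<in> topspace X" and g: "\<forall>n. g n \<in> \<G> n \<and> x \<in> g n"
    have "openin X (\<Inter>j\<le>n. g j)" for n
      using g op by (intro openin_Inter) (auto simp: \<G>_def)
    then show "local_base_at X x (range (\<lambda>n. \<Inter>j\<le>n. g j))"
      using local_base[OF x] g unfolding local_base_at_def by simp
  qed
qed

section \<open>Metrizability\<close>

theorem theorem6:
  fixes X :: "'a topology"
  assumes "t1_space X"
    and "regular_space X"
    and "omega1_compact_space X"
    and "\<exists>\<B>. sharp_base X \<B>"
  shows "metrizable_space X"
proof -
  obtain \<B> where \<B>: "sharp_base X \<B>"
    using assms(4) by blast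
  then obtain \<G> where "weak_development X \<G>"
    using sharp_base_imp_weak_development[OF _ assms(1)] by blast
  then have "second_countable X"
    using Lindelof_weak_development_imp_second_countable
      sharp_base_imp_Lindelof_space[OF \<B> assms(1,3)] by blast
  then show ?thesis
    using regular_second_countable_imp_metrizable_space[OF assms(1,2)] by blast
qed

end
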